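(* (1) Let $x=\langle e_{i_1},\dots,e_{i_r}\rangle$ be a torus-fixed point of $T^*G(r,n)$ (equivalently of $G(r,n)$). Let $V_x(t;q,Q,\hbar)=\sum_{d\ge0}V^d_x(t;q,\hbar)Q^d$ be the quasimap vertex function of $T^*G(r,n)$ localized at $x$ (after absorbing the factor $(-q\hbar^{-1/2})^n$ into $Q$), and let $I(t;q,Q)=\sum_{d\ge0}I_d(t;q)Q^d$ be the $K$-theoretic $I$-function of $G(r,n)$. Then, upon substituting $y=-q^{-1}\hbar$ in the balancing operator $\mathcal B_y$, $$V_x(t;q,Q,\hbar)=\mathcal B_{-q^{-1}\hbar}\big(I(t;q,Q)|_x\big),$$ where the coefficients of $Q^d$ in both functions are equal for every $d\ge0$: $$V^d_x(t;q,\hbar)=\mathcal B_{-q^{-1}\hbar}\big(I_d(t;q)|_x\big).$$ (2) Let $X$ be a smooth projective variety with an action of a torus $T$ such that $X^T$ is finite. Let $\mathcal I=\sum_{d\ge0}\frac{1}{\prod_{i=1}^n(qa_i)_d}Q^d$, where $a_1,\dots,a_n\in K_T(X)$ satisfy $\prod_{i=1}^n(1-a_i)=0$ and the restriction of each $a_i$ to any $x\in X^T$ is a monomial in $K_T(\mathrm{pt})$. Define the operator $\mathcal D=\prod_{i=1}^n\big(1-a_iq^{Q\partial_Q}\big)-Q$. Then, for an appropriate collection of $T\times\mathbb{C}^*_q$-modules in the definition of $\mathcal B_y$ (namely the one-dimensional modules with weights $\{q^l\chi:\ \chi \text{ a weight of } a_i|_x,\ x\in X^T,\ 1\le i\le n,\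 l\in\mathbb{N}\}$), we have: - $\mathcal D$ annihilates $\mathcal I$, that is, $\mathcal D\,\mathcal I=0$; - $\mathcal H_y(\mathcal D)$ annihilates $\mathcal B_y(\mathcal I)$, that is, $\mathcal H_y(\mathcal D)\,\mathcal B_y(\mathcal I)=0$.
   Context: General notation. $\lambda_y(E)=\sum_i y^i[\wedge^iE]$; for a torus representation with weights $\mu_1,\dots,\mu_k$ (with multiplicity), $\lambda_y=\prod_k(1+y\mu_k)$. Pochhammer symbol: $(u)_d=\phi(u)/\phi(q^du)$ with $\phi(u)=\prod_{i\ge0}(1-uq^i)$, for $d\in\mathbb{Z}$. Balancing of classes. Fix a collection of $T\times\mathbb{C}^*_q$-modules $\{V_i\}_{i\in\Lambda}$ with $\lambda_{-1}V_i\ne0$. In the localization of $K_{T\times\mathbb{C}^*_q}(\mathrm{pt})$ at the multiplicative set generated by the $\lambda_{-1}V_i$, let $U$ be the set of finite products $\prod_{i}\frac1{\lambda_{-1}V_{i}}$ over distinct $i\in\Lambda$. Define $$\mathcal B_y\Big(\frac{1}{\prod_i\lambda_{-1}V_i}\Big)=\frac{\prod_i\lambda_yV_i}{\prod_i\lambda_{-1}V_i},$$ extend additively to the monoid $\mathbb{N}\langle U\rangle$ and coefficientwise to power series in $Q$. For a class $\gamma$ on a $T$-variety $X$ with finite $X^T$ (and trivial $\mathbb{C}^*_q$-action) whose restrictions $\gamma|_x$, $x\in X^T$, lie in $\mathbb{N}\langle U\rangle$, $\mathcal B_y(\gamma)$ denotes, whenever it exists, the class with $\mathcal B_y(\gamma)|_x=\mathcal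 B_y(\gamma|_x)$ for all $x\in X^T$. Balancing of difference operators. $q^{Q\partial_Q}$ acts on functions of $Q$ by $f(Q)\mapsto f(qQ)$. For a formal variable $\hbar$, the operator $\mathcal H_\hbar$ acts on a finite product $\prod_i(1-M_i)$, where the $M_i$ are monomials of positive degree in $q^{\pm Q\partial_Q}$ (such as $a_iq^{Q\partial_Q}$), by $$\mathcal H_\hbar\Big(\prod_i(1-M_i)\Big)=\prod_i(1-\hbar M_i)^{-1}\prod_i(1-M_i),\qquad (1-\hbar M)^{-1}=\sum_{k\ge0}\hbar^kM^k,$$ is the identity on elements $L$ not involving $q^{\pm Q\partial_Q}$ (such as $-Q$), and is applied to a sum $\prod_i(1-M_i)+L$ summand by summand. $\mathcal H_y$ is $\mathcal H_\hbar$ with the formal variable called $y$. Data for part (1). $T=(\mathbb{C}^* )^n$ acts diagonally on $\mathbb{C}^n$ with weights $t_1,\dots,t_n$; $\mathbb{C}^*_q$ acts on $\mathbb{P}^1$ by $q\cdot[x:y]=[qx:y]$; $\hbar$ is the weight of the $\mathbb{C}^*$-action scaling the cotangent direction. Write $S=\{i_1,\dots,i_r\}$ for the index set of the fixed point $x$. $I$-function of $G(r,n)$: the space of degree $d$ quasimaps from $\mathbb{P}^1$ to $G(r,n)$ is the (smooth projective) Quot scheme $Quot_{\mathbb{P}^1,d}(\mathbb{C}^n,r)$ of rank $r$, degree $-d$ subsheaves of $\mathbb{C}^n\otimes\mathcal O_{\mathbb{P}^1}$. Let $F_0$ be the locus of quasimaps constant on $\mathbb{P}^1\setminus\{0\}$;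 then $I_d=ev_{\infty,*}\big(\mathcal O_{F_0}/\lambda_{-1}(N^*_{F_0})\big)$, where $N_{F_0}$ is the normal bundle of $F_0$ and $ev_\infty$ is evaluation at $\infty\in\mathbb{P}^1$. (It coincides with the $K$-theoretic $J$-function of $G(r,n)$.) By localization, $$I_d|_x=\sum_{\substack{d_i\ge0\,(i\in S)\\ \sum d_i=d}}ABC,\quad A=\prod_{i\in S}\prod_{j\notin S}\prod_{m=1}^{d_i}\frac1{1-\frac{t_i}{t_j}q^m},\quad B=\prod_{i\in S}\prod_{m=1}^{d_i}\frac1{1-q^m},\quad C=\prod_{\substack{i,j\in S\\ i\ne j}}\ \prod_{m=-d_i}^{-d_i+d_j-1}\frac1{1-\frac{t_i}{t_j}q^{-m}} .$$ The collection of modules used for $\mathcal B_y$ is $\{T^*_zQuot_{\mathbb{P}^1,d}(\mathbb{C}^r,r)\}$, over $d\in\mathbb{Z}$ and $T\times\mathbb{C}^*_q$-fixed points $z$ supported at zero, and the resulting balanced class is taken to be $\mathcal B_y(I_d|_x)=\sum\mathcal B_y(A)\mathcal B_y(B)\mathcal B_y(C)$ (same summation), where $$\mathcal B_y(A)=\prod_{i\in S}\prod_{j\notin S}\prod_{m=1}^{d_i}\frac{1+y\frac{t_i}{t_j}q^m}{1-\frac{t_i}{t_j}q^m},\quad \mathcal B_y(B)=\prod_{i\in S}\prod_{m=1}^{d_i}\frac{1+yq^m}{1-q^m},\quad \mathcal B_y(C)=\prod_{\substack{i,j\in S\\ i\ne j}}\ \prod_{m=-d_i}^{-d_i+d_j-1}\frac{1+y\frac{t_i}{t_j}q^{-m}}{1-\frac{t_i}{t_j}q^{-m}}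 .$$ Vertex function: $V_x$ is the localization at $x$ of $\sum_{d\ge0}Q^d\,ev_{\infty,*}(QM^d_\infty,\hat{\mathcal O}^{\mathrm{vir}}_d)$, where $QM^d_\infty$ is the moduli space of degree $d$ stable quasimaps $\mathbb{P}^1\to T^*G(r,n)$ nonsingular at $\infty$ and $\hat{\mathcal O}^{\mathrm{vir}}_d=\mathcal O^{\mathrm{vir}}_d\otimes\mathcal K_{\mathrm{vir}}^{1/2}$ is the symmetrized virtual structure sheaf ($\mathcal K_{\mathrm{vir}}$ the virtual canonical bundle). By Pushkar, Smirnov and Zeitlin, after absorbing the factor $(-q\hbar^{-1/2})^n$ into $Q$, $$V_x^d(t;q,\hbar)=\sum_{\substack{d_i\ge0\,(i\in S)\\ \sum d_i=d}}\ \prod_{i,j\in S}\Big\{\tfrac{t_j}{t_i}\Big\}^{-1}_{d_i-d_j}\prod_{i\in S}\prod_{j=1}^n\Big\{\tfrac{t_j}{t_i}\Big\}_{d_i},\qquad \{u\}_d=\frac{(\hbar/u)_d}{(q/u)_d}.$$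
   Formalization: In (2), H_{-y}(D), not H_y(D), annihilates B_y(I) (as stated it fails for X a point, n=1, a_1=1), and weights q^l·chi have l>=1; in (1), V_x and I|_x are the explicit localization formulas, and modules giving the factors A are added to the collection. *)

theory Defs
  imports
    "HOL-Library.Poly_Mapping"
    "HOL-Library.Multiset"
    "HOL-Library.FuncSet"
    "HOL-Computational_Algebra.Polynomial_Factorial"
    "HOL-Computational_Algebra.Polynomial_FPS"
    "HOL-Analysis.Infinite_Products"
begin

section \<open>Representation rings of tori\<close>

text \<open>
  A character of a torus is an integer exponent vector. Coordinate 0 is the exponent of \<open>q\<close>,
  coordinate 1 that of \<open>\<hbar>\<close>, and coordinate \<open>i + 1\<close> (for \<open>i \<ge> 1\<close>) that of \<open>t\<^sub>i\<close>. A torus of any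
  rank is accommodated by using finitely many coordinates. Characters are written additively; the
  representation ring is the group ring of the character lattice, that is, the ring of Laurent
  polynomials, and every localization of it sits inside its field of fractions. A
  finite-dimensional representation is the multiset of its weights.
\<close>

type_synonym weight = "nat \<Rightarrow>\<^sub>0 int"
type_synonym Kpt = "weight \<Rightarrow>\<^sub>0 int"
type_synonym Kloc = "Kpt fract"
type_synonym torus_rep = "weight multiset"

definition qw :: "int \<Rightarrow> weight" where "qw l = Poly_Mapping.single 0 l"
definition hw :: weight where "hw = Poly_Mapping.single 1 1"
definition tw :: "nat \<Rightarrow> weight" where "tw i = Poly_Mapping.single (Suc i) 1"

definition emon :: "weight \<Rightarrow> Kpt" where "emon \<mu> = Poly_Mapping.single \<mu> 1"

definition qF :: Kloc where "qF = to_fract (emon (qw 1))"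
definition hF :: Kloc where "hF = to_fract (emon hw)"
definition tF :: "nat \<Rightarrow> Kloc" where "tF i = to_fract (emon (tw i))"

text \<open>\<open>\<lambda>\<^sub>y(E)\<close> as a polynomial in the formal variable \<open>y\<close>, and its value at \<open>y = -1\<close>.\<close>

definition lam :: "torus_rep \<Rightarrow> Kpt poly" where
  "lam E = (\<Prod>\<mu>\<in>#E. [:1, emon \<mu>:])"

definition lam_m1 :: "torus_rep \<Rightarrow> Kpt" where
  "lam_m1 E = poly (lam E) (-1)"


section \<open>Balancing of classes\<close>

text \<open>
  A collection of modules is a family \<open>V\<close> indexed by \<open>\<Lambda>\<close> (so the same module may occur at several
  indices). The operator \<open>\<B>\<^sub>y\<close> is not well defined on elements of the localized ring: from
  \<open>1/(1-t) + 1/(1-t\<^sup>-\<^sup>1) = 1\<close> one would get \<open>1 - y = 1\<close>. It is therefore defined, as the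
  notation \<open>\<nat>\<langle>U\<rangle>\<close> suggests, on formal sums of products: a finite index set \<open>J \<subseteq> \<Lambda>\<close> stands for
  \<open>\<Prod>\<^sub>i\<^sub>\<in>\<^sub>J 1/\<lambda>\<^sub>-\<^sub>1 V\<^sub>i\<close>, and a multiset of such sets for the sum of these products.
\<close>

definition module_collection :: "'i set \<Rightarrow> ('i \<Rightarrow> torus_rep) \<Rightarrow> bool" where
  "module_collection \<Lambda> V \<longleftrightarrow> (\<forall>i\<in>\<Lambda>. lam_m1 (V i) \<noteq> 0)"

definition formal_sums :: "'i set \<Rightarrow> 'i set multiset set" where
  "formal_sums \<Lambda> = {p. \<forall>J\<in>#p. finite J \<and> J \<subseteq> \<Lambda>}"

definition class_of :: "('i \<Rightarrow> torus_rep) \<Rightarrow> 'i set multiset \<Rightarrow> Kloc" where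
  "class_of V p = (\<Sum>J\<in>#p. 1 / to_fract (\<Prod>i\<in>J. lam_m1 (V i)))"

definition balance :: "('i \<Rightarrow> torus_rep) \<Rightarrow> 'i set multiset \<Rightarrow> Kloc poly" where
  "balance V p =
     (\<Sum>J\<in>#p. smult (1 / to_fract (\<Prod>i\<in>J. lam_m1 (V i))) (fract_poly (\<Prod>i\<in>J. lam (V i))))"


section \<open>Pochhammer symbols\<close>

definition qpoch_nat :: "'a::comm_ring_1 \<Rightarrow> 'a \<Rightarrow> nat \<Rightarrow> 'a" where
  "qpoch_nat q u d = (\<Prod>k<d. 1 - u * q ^ k)"

text \<open>
  \<open>(u)\<^sub>d = \<phi>(u)/\<phi>(q\<^sup>d u)\<close> for \<open>d \<in> \<int>\<close>, with the common factors of the two infinite products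
  cancelled so that it makes sense in any field; see \<open>qpoch_eq_phi\<close> below.
\<close>

definition qpoch :: "'a::field \<Rightarrow> 'a \<Rightarrow> int \<Rightarrow> 'a" where
  "qpoch q u d =
     (if d \<ge> 0 then qpoch_nat q u (nat d) else 1 / qpoch_nat q (q powi d * u) (nat (- d)))"

definition phi :: "complex \<Rightarrow> complex \<Rightarrow> complex" where
  "phi q u = prodinf (\<lambda>i. 1 - u * q ^ i)"

lemma phi_split:
  assumes q: "norm q < 1" and nz: "\<And>k. u * q ^ (k + N) \<noteq> 1"
  shows "phi q u = qpoch_nat q u N * phi q (q ^ N * u)" "phi q (q ^ N * u) \<noteq> 0"
proof -
  have conv: "convergent_prod (\<lambda>i. 1 - v * q ^ i)" for v
  proof -
    have "summable (\<lambda>i. norm (v * q ^ i))"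
      using q by (simp add: norm_mult norm_power summable_mult summable_geometric)
    then have "summable (\<lambda>i. norm ((1 - v * q ^ i) - 1))" by simp
    then show ?thesis
      by (intro abs_convergent_prod_imp_convergent_prod summable_imp_abs_convergent_prod)
  qed
  have nz': "1 - q ^ N * u * q ^ k \<noteq> 0" for k
    using nz[of k] by (simp add: power_add algebra_simps)
  show "phi q (q ^ N * u) \<noteq> 0"
    unfolding phi_def using prodinf_nonzero[OF conv nz'] .
  have l1: "(\<lambda>n. \<Prod>i\<le>n. 1 - v * q ^ i) \<longlonglongrightarrow> phi q v" for v
    unfolding phi_def by (rule convergent_prod_LIMSEQ[OF conv])
  have split: "(\<Prod>i\<le>n + N. 1 - u * q ^ i) = qpoch_nat q u N * (\<Prod>i\<le>n. 1 - q ^ N * u * q ^ i)" for n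
  proof -
    have "(\<Prod>i<N + m. f i) = (\<Prod>i<N. f i) * (\<Prod>i<m. f (N + i))"
      for f :: "nat \<Rightarrow> complex" and m
      by (induction m) (simp_all add: mult_ac)
    from this[of "\<lambda>i. 1 - u * q ^ i" "Suc n"] show ?thesis
      by (simp add: qpoch_nat_def power_add lessThan_Suc_atMost ac_simps)
  qed
  have "(\<lambda>n. \<Prod>i\<le>n + N. 1 - u * q ^ i) \<longlonglongrightarrow> phi q u"
    using LIMSEQ_ignore_initial_segment[OF l1[of u], of N] .
  moreover have "(\<lambda>n. \<Prod>i\<le>n + N. 1 - u * q ^ i) \<longlonglongrightarrow> qpoch_nat q u N * phi q (q ^ N * u)"
    unfolding split by (intro tendsto_mult tendsto_const l1)
  ultimately show "phi q u = qpoch_nat q u N * phi q (q ^ N * u)"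
    by (rule LIMSEQ_unique)
qed

lemma qpoch_eq_phi:
  fixes q u :: complex
  assumes q: "q \<noteq> 0" "norm q < 1" and nz: "\<And>k::nat. q powi d * u * q ^ k \<noteq> 1"
  shows "qpoch q u d = phi q u / phi q (q powi d * u)"
proof (cases "d \<ge> 0")
  case True
  then have p: "q powi d = q ^ nat d" by (simp add: power_int_def)
  have "u * q ^ (k + nat d) \<noteq> 1" for k
    using nz[of k] by (simp add: p power_add algebra_simps)
  from phi_split[OF q(2) this] show ?thesis using True by (simp add: qpoch_def p)
next
  case False
  define v where "v = q powi d * u"
  have u: "u = q ^ nat (- d) * v"
    using False q(1) by (simp add: v_def power_int_def power_inverse)
  have "v * q ^ (k + nat (- d)) \<noteq> 1" for k
    using nz[of "k + nat (- d)"] by (simp add: v_def)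
  from phi_split[OF q(2) this] show ?thesis
    using False by (simp add: qpoch_def v_def[symmetric] u[symmetric])
qed


section \<open>The vertex function and the \<open>I\<close>-function of a Grassmannian\<close>

text \<open>
  \<open>S\<close> is the index set of the fixed point. The splittings \<open>(d\<^sub>i)\<close> of the degree \<open>d\<close> are functions on
  \<open>S\<close>, extensional so that there are finitely many.
\<close>

definition degree_splittings :: "nat set \<Rightarrow> nat \<Rightarrow> (nat \<Rightarrow> nat) set" where
  "degree_splittings S d = {\<delta> \<in> S \<rightarrow>\<^sub>E UNIV. (\<Sum>i\<in>S. \<delta> i) = d}"

definition vertex_bracket :: "Kloc \<Rightarrow> int \<Rightarrow> Kloc" where
  "vertex_bracket u d = qpoch qF (hF / u) d / qpoch qF (qF / u) d"

text \<open>The formula of Pushkar, Smirnov and Zeitlin, with \<open>(-q\<hbar>\<^sup>-\<^sup>1\<^sup>/\<^sup>2)\<^sup>n\<close> absorbed into \<open>Q\<close>.\<close>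

definition vertex_coeff :: "nat \<Rightarrow> nat set \<Rightarrow> nat \<Rightarrow> Kloc" where
  "vertex_coeff n S d =
     (\<Sum>\<delta>\<in>degree_splittings S d.
        (\<Prod>i\<in>S. \<Prod>j\<in>S. inverse (vertex_bracket (tF j / tF i) (int (\<delta> i) - int (\<delta> j)))) *
        (\<Prod>i\<in>S. \<Prod>j=1..n. vertex_bracket (tF j / tF i) (int (\<delta> i))))"

definition vertex_function :: "nat \<Rightarrow> nat set \<Rightarrow> Kloc fps" where
  "vertex_function n S = Abs_fps (vertex_coeff n S)"

text \<open>The localization formula for \<open>I\<^sub>d\<close> restricted to the fixed point, with its three factors.\<close>

definition I_A :: "nat \<Rightarrow> nat set \<Rightarrow> (nat \<Rightarrow> nat) \<Rightarrow> Kloc" where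
  "I_A n S \<delta> = (\<Prod>i\<in>S. \<Prod>j\<in>{1..n} - S. \<Prod>m=1..\<delta> i. 1 / (1 - tF i / tF j * qF ^ m))"

definition I_B :: "nat set \<Rightarrow> (nat \<Rightarrow> nat) \<Rightarrow> Kloc" where
  "I_B S \<delta> = (\<Prod>i\<in>S. \<Prod>m=1..\<delta> i. 1 / (1 - qF ^ m))"

definition I_C :: "nat set \<Rightarrow> (nat \<Rightarrow> nat) \<Rightarrow> Kloc" where
  "I_C S \<delta> = (\<Prod>i\<in>S. \<Prod>j\<in>S - {i}. \<Prod>m=- int (\<delta> i)..- int (\<delta> i) + int (\<delta> j) - 1.
      1 / (1 - tF i / tF j * qF powi (- m)))"

definition I_coeff :: "nat \<Rightarrow> nat set \<Rightarrow> nat \<Rightarrow> Kloc" where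
  "I_coeff n S d = (\<Sum>\<delta>\<in>degree_splittings S d. I_A n S \<delta> * I_B S \<delta> * I_C S \<delta>)"

definition I_function :: "nat \<Rightarrow> nat set \<Rightarrow> Kloc fps" where
  "I_function n S = Abs_fps (I_coeff n S)"

text \<open>
  At the fixed point \<open>z = \<Oplus>\<^sub>i\<^sub>\<in>\<^sub>S t\<^sub>i \<O>(-\<delta>\<^sub>i[0])\<close> the tangent space \<open>Hom(z, \<O>\<^sup>S/z)\<close> of the Quot scheme
  of \<open>\<complex>\<^sup>r\<close> has weights \<open>(t\<^sub>j/t\<^sub>i) q\<^sup>m\<close> for \<open>-\<delta>\<^sub>i \<le> m < -\<delta>\<^sub>i + \<delta>\<^sub>j\<close>. Its dual \<open>Quot_cot\<close> accounts for
  \<open>B\<close> (\<open>i = j\<close>) and \<open>C\<close> (\<open>i \<noteq> j\<close>). The remaining cotangent directions in the Quot scheme of \<open>\<complex>\<^sup>n\<close>,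
  transverse to those and to the directions moving the fixed point of \<open>G(r,n)\<close>, give \<open>A\<close>;
  they form the module \<open>Quot_cot_normal\<close>.
\<close>

definition Quot_cot :: "nat set \<Rightarrow> (nat \<Rightarrow> nat) \<Rightarrow> torus_rep" where
  "Quot_cot S \<delta> = (\<Sum>i\<in>S. \<Sum>j\<in>S. \<Sum>m=- int (\<delta> i)..- int (\<delta> i) + int (\<delta> j) - 1.
      {# tw i - tw j + qw (- m) #})"

definition Quot_cot_normal :: "nat \<Rightarrow> nat set \<Rightarrow> (nat \<Rightarrow> nat) \<Rightarrow> torus_rep" where
  "Quot_cot_normal n S \<delta> = (\<Sum>i\<in>S. \<Sum>j\<in>{1..n} - S. \<Sum>m=1..\<delta> i.
      {# tw i - tw j + qw (int m) #})"

datatype Quot_index = Cot "nat \<Rightarrow> nat" | CotNormal "nat \<Rightarrow> nat"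

definition Quot_indices :: "nat set \<Rightarrow> Quot_index set" where
  "Quot_indices S = Cot ` (S \<rightarrow>\<^sub>E UNIV) \<union> CotNormal ` (S \<rightarrow>\<^sub>E UNIV)"

fun Quot_module :: "nat \<Rightarrow> nat set \<Rightarrow> Quot_index \<Rightarrow> torus_rep" where
  "Quot_module n S (Cot \<delta>) = Quot_cot S \<delta>"
| "Quot_module n S (CotNormal \<delta>) = Quot_cot_normal n S \<delta>"

text \<open>The formal sum of products given by the localization formula for \<open>I\<^sub>d\<close>.\<close>

definition I_formal :: "nat set \<Rightarrow> nat \<Rightarrow> Quot_index set multiset" where
  "I_formal S d = image_mset (\<lambda>\<delta>. {Cot \<delta>, CotNormal \<delta>}) (mset_set (degree_splittings S d))"

definition I_balanced_coeff :: "nat \<Rightarrow> nat set \<Rightarrow> nat \<Rightarrow> Kloc poly" where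
  "I_balanced_coeff n S d = balance (Quot_module n S) (I_formal S d)"

text \<open>The balanced factors, for comparison with \<open>I_balanced_coeff\<close>.\<close>

definition bal_A :: "Kloc \<Rightarrow> nat \<Rightarrow> nat set \<Rightarrow> (nat \<Rightarrow> nat) \<Rightarrow> Kloc" where
  "bal_A y n S \<delta> = (\<Prod>i\<in>S. \<Prod>j\<in>{1..n} - S. \<Prod>m=1..\<delta> i.
      (1 + y * (tF i / tF j) * qF ^ m) / (1 - tF i / tF j * qF ^ m))"

definition bal_B :: "Kloc \<Rightarrow> nat set \<Rightarrow> (nat \<Rightarrow> nat) \<Rightarrow> Kloc" where
  "bal_B y S \<delta> = (\<Prod>i\<in>S. \<Prod>m=1..\<delta> i. (1 + y * qF ^ m) / (1 - qF ^ m))"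

definition bal_C :: "Kloc \<Rightarrow> nat set \<Rightarrow> (nat \<Rightarrow> nat) \<Rightarrow> Kloc" where
  "bal_C y S \<delta> = (\<Prod>i\<in>S. \<Prod>j\<in>S - {i}. \<Prod>m=- int (\<delta> i)..- int (\<delta> i) + int (\<delta> j) - 1.
      (1 + y * (tF i / tF j) * qF powi (- m)) / (1 - tF i / tF j * qF powi (- m)))"

definition I_balanced :: "Kloc \<Rightarrow> nat \<Rightarrow> nat set \<Rightarrow> Kloc fps" where
  "I_balanced y n S = Abs_fps (\<lambda>d. poly (I_balanced_coeff n S d) y)"


section \<open>K-theory classes determined by their restrictions to fixed points\<close>

definition ring_hom_map :: "('a::comm_ring_1 \<Rightarrow> 'b::comm_ring_1) \<Rightarrow> bool" where
  "ring_hom_map f \<longleftrightarrow>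
     f 1 = 1 \<and> (\<forall>u v. f (u + v) = f u + f v) \<and> (\<forall>u v. f (u * v) = f u * f v)"

text \<open>
  \<open>'k\<close> plays the role of (a localization of) the equivariant K-ring of \<open>X\<close>: an algebra over the
  representation ring via \<open>\<iota>\<close>, with restriction maps \<open>res x\<close> to the points \<open>x\<close> of the finite set
  \<open>P = X\<^sup>T\<close>, jointly injective by the localization theorem.
\<close>

definition fixed_point_K_ring ::
    "'x set \<Rightarrow> (Kpt \<Rightarrow> 'k::comm_ring_1) \<Rightarrow> ('x \<Rightarrow> 'k \<Rightarrow> Kloc) \<Rightarrow> bool" where
  "fixed_point_K_ring P \<iota> res \<longleftrightarrow>
     finite P \<and> ring_hom_map \<iota> \<and>
     (\<forall>x\<in>P. ring_hom_map (res x) \<and> (\<forall>c. res x (\<iota> c) = to_fract c)) \<and>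
     (\<forall>u v. (\<forall>x\<in>P. res x u = res x v) \<longrightarrow> u = v)"

text \<open>
  \<open>B\<close> is \<open>\<B>\<^sub>y(\<gamma>)\<close> for a power series \<open>\<gamma>\<close> in \<open>Q\<close>, where the formal sum \<open>pres x d\<close> presents the
  restriction to \<open>x\<close> of the coefficient of \<open>Q\<^sup>d\<close>.
\<close>

definition is_balanced_class ::
    "'x set \<Rightarrow> ('x \<Rightarrow> 'k::comm_ring_1 \<Rightarrow> Kloc) \<Rightarrow> 'i set \<Rightarrow> ('i \<Rightarrow> torus_rep) \<Rightarrow>
     ('x \<Rightarrow> nat \<Rightarrow> 'i set multiset) \<Rightarrow> 'k fps \<Rightarrow> 'k poly fps \<Rightarrow> bool" where
  "is_balanced_class P res \<Lambda> V pres \<gamma> B \<longleftrightarrow>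
     (\<forall>x\<in>P. \<forall>d. pres x d \<in> formal_sums \<Lambda> \<and>
        class_of V (pres x d) = res x (fps_nth \<gamma> d) \<and>
        balance V (pres x d) = map_poly (res x) (fps_nth B d))"


section \<open>Difference operators and their balancing\<close>

type_synonym 'b operator = "'b fps \<Rightarrow> 'b fps"

text \<open>\<open>q\<^sup>Q\<^sup>\<partial>\<close>, that is \<open>f(Q) \<mapsto> f(qQ)\<close>.\<close>

definition q_shift :: "'b::comm_ring_1 \<Rightarrow> 'b operator" where
  "q_shift q f = Abs_fps (\<lambda>d. q ^ d * fps_nth f d)"

text \<open>
  The balancing of an operator depends on its presentation as \<open>\<Prod>\<^sub>i (1 - M\<^sub>i) + L\<close>, so it is defined on
  such expressions.
\<close>

datatype 'b op_expr = ProdPlus (factors: "'b operator list") (rest: "'b operator")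

definition apply_factors :: "'b::comm_ring_1 operator list \<Rightarrow> 'b operator" where
  "apply_factors Ms = foldr (\<lambda>M g. (\<lambda>f. f - M f) \<circ> g) Ms id"

definition apply_expr :: "'b::comm_ring_1 op_expr \<Rightarrow> 'b operator" where
  "apply_expr E f = apply_factors (factors E) f + rest E f"

text \<open>
  \<open>(1 - h M)\<^sup>-\<^sup>1 = \<Sum>\<^sub>k h\<^sup>k M\<^sup>k\<close> acting on power series in \<open>Q\<close> with coefficients in \<open>'k[[y]]\<close>, where \<open>h\<close> is
  a series in \<open>y\<close> without constant term: only \<open>k \<le> m\<close> contributes to the coefficient of \<open>y\<^sup>m\<close>.
\<close>

definition geometric_op :: "'k::comm_ring_1 fps \<Rightarrow> 'k fps operator \<Rightarrow> 'k fps operator" where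
  "geometric_op h M f =
     Abs_fps (\<lambda>d. Abs_fps (\<lambda>m. \<Sum>k\<le>m. fps_nth (h ^ k * fps_nth ((M ^^ k) f) d) m))"

text \<open>
  \<open>\<H>\<^sub>h\<close>. With \<open>\<B>\<^sub>y(1/(1-\<chi>)) = (1+y\<chi>)/(1-\<chi>)\<close>, the operator belonging to \<open>\<B>\<^sub>y\<close> is the one whose
  inverted factors are \<open>1 + yM\<close>, that is \<open>h = -y\<close>. The choice \<open>h = y\<close> fails already for \<open>X\<close> a point,
  \<open>n = 1\<close>, \<open>a\<^sub>1 = 1\<close>: the coefficient of \<open>Q\<close> in \<open>\<H>\<^sub>y(\<D>) \<B>\<^sub>y(\<I>)\<close> is then \<open>(1+yq)/(1-yq) - 1\<close>.
\<close>

definition balance_op :: "'k::comm_ring_1 fps \<Rightarrow> 'k fps op_expr \<Rightarrow> 'k fps operator" where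
  "balance_op h E f =
     foldr (\<lambda>M g. geometric_op h M \<circ> g) (factors E) id (apply_factors (factors E) f) + rest E f"


section \<open>The series \<open>\<I>\<close> and the operator \<open>\<D>\<close>\<close>

definition ring_inverse :: "'k::comm_ring_1 \<Rightarrow> 'k" where
  "ring_inverse u = (THE v. u * v = 1)"

definition I_denominator :: "(Kpt \<Rightarrow> 'k::comm_ring_1) \<Rightarrow> nat \<Rightarrow> (nat \<Rightarrow> 'k) \<Rightarrow> nat \<Rightarrow> 'k" where
  "I_denominator \<iota> n a d = (\<Prod>i=1..n. qpoch_nat (\<iota> (emon (qw 1))) (\<iota> (emon (qw 1)) * a i) d)"

definition I_series :: "(Kpt \<Rightarrow> 'k::comm_ring_1) \<Rightarrow> nat \<Rightarrow> (nat \<Rightarrow> 'k) \<Rightarrow> 'k fps" where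
  "I_series \<iota> n a = Abs_fps (\<lambda>d. ring_inverse (I_denominator \<iota> n a d))"

definition D_expr :: "'b::comm_ring_1 \<Rightarrow> nat \<Rightarrow> (nat \<Rightarrow> 'b) \<Rightarrow> 'b op_expr" where
  "D_expr q n a =
     ProdPlus (map (\<lambda>i f. fps_const (a i) * q_shift q f) [1..<Suc n]) (\<lambda>f. - fps_X * f)"

text \<open>
  The one-dimensional modules of weights \<open>q\<^sup>l \<xi>\<close>, where \<open>\<xi> x i\<close> is the weight of \<open>a\<^sub>i\<close> at \<open>x\<close>. Here
  \<open>l \<ge> 1\<close>: these are the weights occurring in \<open>\<I>\<close>, and \<open>l = 0\<close> would violate \<open>\<lambda>\<^sub>-\<^sub>1 \<noteq> 0\<close> because some
  \<open>\<xi> x i\<close> is trivial.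
\<close>

definition weight_indices :: "'x set \<Rightarrow> nat \<Rightarrow> ('x \<times> nat \<times> nat) set" where
  "weight_indices P n = {(x, i, l). x \<in> P \<and> i \<in> {1..n} \<and> l \<ge> 1}"

definition weight_module :: "('x \<Rightarrow> nat \<Rightarrow> weight) \<Rightarrow> 'x \<times> nat \<times> nat \<Rightarrow> torus_rep" where
  "weight_module \<xi> = (\<lambda>(x, i, l). {# \<xi> x i + qw (int l) #})"

text \<open>\<open>\<I>\<^sub>d\<close> restricts at \<open>x\<close> to the single product over all \<open>i\<close> and all \<open>1 \<le> l \<le> d\<close>.\<close>

definition I_series_formal :: "nat \<Rightarrow> 'x \<Rightarrow> nat \<Rightarrow> ('x \<times> nat \<times> nat) set multiset" where
  "I_series_formal n x d = {# {x} \<times> {1..n} \<times> {1..d} #}"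

text \<open>A class with polynomial dependence on \<open>y\<close> as a class over the ring of power series in \<open>y\<close>.\<close>

definition in_series_y :: "'k::comm_ring_1 poly fps \<Rightarrow> 'k fps fps" where
  "in_series_y B = Abs_fps (\<lambda>d. fps_of_poly (fps_nth B d))"

end

theory Submission
  imports Defs
begin

text \<open>
  Both parts rest on the same observation: balancing multiplies each factor \<open>1/(1 - \<mu>)\<close> by
  \<open>1 + y\<mu>\<close>, so every claim is about products of factors \<open>(1 + y\<mu>)/(1 - \<mu>)\<close> indexed by weights.

  For the Grassmannian, write \<open>g(m) = (1 + y w q\<^sup>m)/(1 - w q\<^sup>m)\<close> with \<open>w = t\<^sub>i/t\<^sub>j\<close> and
  \<open>y = -\<hbar>/q\<close>. Then \<open>1 + y w q\<^sup>m = 1 - \<hbar> w q\<^sup>m\<^sup>-\<^sup>1\<close>, and the bracket \<open>{1/w}\<^sub>d\<close> is the product of \<open>g(m)\<close>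
  over \<open>1 \<le> m \<le> d\<close>, where for negative \<open>d\<close> such a product means the inverse of the product over
  \<open>d < m \<le> 0\<close>. Products of this kind telescope: \<open>{1/w}\<^sub>a / {1/w}\<^sub>a\<^sub>-\<^sub>b\<close> is the product of
  \<open>g(m)\<close> over \<open>a - b < m \<le> a\<close> (\<open>vertex_bracket_quotient\<close>). For each splitting \<open>\<delta>\<close> of the degree, the
  pairs \<open>(i, j)\<close> with \<open>j\<close> outside \<open>S\<close> give \<open>\<B>(A)\<close>, those with \<open>i = j\<close> give \<open>\<B>(B)\<close>, where the bracket
  \<open>{1}\<^sub>0 = 1\<close> contributes nothing, and the other pairs in \<open>S\<close> give \<open>\<B>(C)\<close> by telescoping. So the
  vertex function and the balanced \<open>I\<close>-function agree term by term
  (\<open>vertex_term_eq_balanced_term\<close>).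

  For the series \<open>\<I>\<close>, the operator \<open>1 - a\<^sub>i q\<^sup>Q\<^sup>\<partial>\<close> multiplies the coefficient of \<open>Q\<^sup>d\<close> by
  \<open>1 - a\<^sub>i q\<^sup>d\<close>. The product of these scalars turns \<open>\<I>\<^sub>d\<close> into \<open>\<I>\<^sub>d\<^sub>-\<^sub>1\<close>, and for \<open>d = 0\<close> it is
  \<open>\<Prod>\<^sub>i (1 - a\<^sub>i) = 0\<close>; hence \<open>\<D>\<I> = 0\<close>. The balanced coefficient is
  \<open>\<I>\<^sub>d \<Prod>\<^sub>i \<Prod>\<^sub>l (1 + y q\<^sup>l a\<^sub>i)\<close> with \<open>1 \<le> l \<le> d\<close>, so the same operators now leave the extra factor
  \<open>\<Prod>\<^sub>i (1 + y a\<^sub>i q\<^sup>d)\<close>, and the inverted factors of the balanced operator divide by exactly this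
  (\<open>foldr_geometric_op_cancel\<close>). It remains to see that the denominators of \<open>\<I>\<close>
  are units in the K-ring and not only at the fixed points. This holds because \<open>a\<^sub>i\<close> is a root of the
  monic polynomial whose roots are its restrictions, so that \<open>1 - q\<^sup>l a\<^sub>i\<close> divides the product of its
  own restrictions (\<open>one_minus_power_unit\<close>).
\<close>

section \<open>Characters in the localized representation ring\<close>

definition character :: "weight \<Rightarrow> Kloc" where
  "character \<mu> = to_fract (emon \<mu>)"

lemma emon_add: "emon (\<mu> + \<nu>) = emon \<mu> * emon \<nu>"
  by (simp add: emon_def mult_single)

lemma emon_0 [simp]: "emon 0 = 1"
  by (simp add: emon_def)

lemma emon_eq_1_iff: "emon \<mu> = 1 \<longleftrightarrow> \<mu> = 0"
proof
  assume "emon \<mu> = 1"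
  then have "Poly_Mapping.lookup (Poly_Mapping.single \<mu> (1::int)) \<mu>
      = Poly_Mapping.lookup (Poly_Mapping.single 0 1) \<mu>"
    by (simp only: emon_def single_one)
  then show "\<mu> = 0" by (simp del: single_one add: lookup_single when_def split: if_splits)
qed simp

lemma qw_Suc: "qw (int (Suc m)) = qw 1 + qw (int m)"
  by (simp only: qw_def single_add[symmetric] of_nat_Suc)

lemma emon_qw_power: "emon (qw (int m)) = emon (qw 1) ^ m"
proof (induction m)
  case (Suc m)
  then show ?case by (simp only: qw_Suc emon_add power_Suc)
qed (simp add: qw_def)

lemma character_add: "character (\<mu> + \<nu>) = character \<mu> * character \<nu>"
  by (simp add: character_def emon_add)

lemma character_eq_1_iff: "character \<mu> = 1 \<longleftrightarrow> \<mu> = 0"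
  unfolding character_def emon_eq_1_iff[symmetric]
  by (metis to_fract_1 to_fract_eq_iff)

lemma character_nonzero [simp]: "character \<mu> \<noteq> 0"
proof
  assume "character \<mu> = 0"
  then have "character (\<mu> + - \<mu>) = 0" by (simp only: character_add mult_zero_left)
  then show False by (simp add: character_def)
qed

lemma character_diff: "character (\<mu> - \<nu>) = character \<mu> / character \<nu>"
proof -
  have "character (\<mu> - \<nu>) * character \<nu> = character \<mu>"
    by (simp add: character_add[symmetric])
  then show ?thesis by (simp add: field_simps)
qed

lemma character_tw: "character (tw i) = tF i"
  and character_hw: "character hw = hF"
  by (simp_all add: character_def tF_def hF_def)

lemma character_qw_nat: "character (qw (int m)) = qF ^ m"
proof (induction m)
  case (Suc m)
  then show ?case by (simp only: qw_Suc character_add power_Suc) (simp add: character_def qF_def)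
qed (simp add: character_def qw_def)

lemma character_qw: "character (qw m) = qF powi m"
proof (cases "m \<ge> 0")
  case True
  then show ?thesis using character_qw_nat[of "nat m"] by (simp add: power_int_def)
next
  case False
  then have "qw m = 0 - qw (int (nat (- m)))"
    by (simp add: qw_def single_uminus)
  then have "character (qw m) = character 0 / character (qw (int (nat (- m))))"
    by (simp only: character_diff)
  then show ?thesis
    using False unfolding character_qw_nat
    by (simp add: character_def power_int_def field_simps)
qed

lemma qF_nonzero [simp]: "qF \<noteq> 0" and hF_nonzero [simp]: "hF \<noteq> 0" and tF_nonzero [simp]: "tF i \<noteq> 0"
  using character_nonzero[of "qw 1"] character_nonzero[of hw] character_nonzero[of "tw i"]
  by (simp_all add: character_def qF_def hF_def tF_def)

lemma character_root: "character (tw i - tw j + qw m) = tF i / tF j * qF powi m"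
  by (simp only: character_add character_diff character_tw character_qw)


section \<open>Balancing as a product over weights\<close>

definition balanced_factor :: "Kloc \<Rightarrow> torus_rep \<Rightarrow> Kloc" where
  "balanced_factor y E = (\<Prod>\<mu>\<in>#E. (1 + y * character \<mu>) / (1 - character \<mu>))"

lemma balanced_factor_empty [simp]: "balanced_factor y {#} = 1"
  and balanced_factor_add: "balanced_factor y (E + F) = balanced_factor y E * balanced_factor y F"
  and balanced_factor_single: "balanced_factor y {#\<mu>#} = (1 + y * character \<mu>) / (1 - character \<mu>)"
  by (simp_all add: balanced_factor_def)

lemma balanced_factor_sum: "balanced_factor y (\<Sum>i\<in>A. E i) = (\<Prod>i\<in>A. balanced_factor y (E i))"
  by (induction A rule: infinite_finite_induct) (simp_all add: balanced_factor_add)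

lemma lam_m1_prod: "lam_m1 E = (\<Prod>\<mu>\<in>#E. 1 - emon \<mu>)"
  by (induction E) (simp_all add: lam_m1_def lam_def algebra_simps)

lemma lam_m1_nonzero: "0 \<notin># E \<Longrightarrow> lam_m1 E \<noteq> 0"
proof (induction E)
  case (add \<mu> E)
  then show ?case using emon_eq_1_iff[of \<mu>] by (auto simp: lam_m1_prod)
qed (simp add: lam_m1_prod)

lemma poly_lam: "poly (fract_poly (lam E)) y = (\<Prod>\<mu>\<in>#E. 1 + y * character \<mu>)"
  by (induction E) (simp_all add: lam_def map_poly_pCons character_def algebra_simps)

lemma to_fract_lam_m1: "to_fract (lam_m1 E) = (\<Prod>\<mu>\<in>#E. 1 - character \<mu>)"
  by (induction E) (simp_all add: lam_m1_prod character_def)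

lemma balanced_factor_eq: "balanced_factor y E = poly (fract_poly (lam E)) y / to_fract (lam_m1 E)"
  unfolding poly_lam to_fract_lam_m1 by (induction E) (simp_all add: balanced_factor_def)

lemma to_fract_power: "to_fract (u ^ k) = to_fract u ^ k"
  by (induction k) simp_all

lemma to_fract_prod: "to_fract (\<Prod>i\<in>A. f i) = (\<Prod>i\<in>A. to_fract (f i))"
  by (induction A rule: infinite_finite_induct) simp_all

lemma fract_poly_prod: "fract_poly (\<Prod>i\<in>A. f i) = (\<Prod>i\<in>A. fract_poly (f i))"
  by (induction A rule: infinite_finite_induct) simp_all

text \<open>
  Read at a value of \<open>y\<close>, balancing becomes multiplicative in the modules and in their weights. All
  explicit formulas below are instances of this one.
\<close>

lemma poly_balance: "poly (balance V p) y = (\<Sum>J\<in>#p. \<Prod>i\<in>J. balanced_factor y (V i))"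
  by (induction p)
    (simp_all add: balance_def balanced_factor_eq to_fract_prod fract_poly_prod poly_prod prod_dividef)

text \<open>
  At \<open>y = 0\<close> all numerators become \<open>1\<close>. Hence the localization formula for \<open>I\<^sub>d\<close> is the case
  \<open>y = 0\<close> of the formula for its balancing.
\<close>

lemma class_of_eq_poly_balance: "class_of V p = poly (balance V p) 0"
proof -
  have "poly (fract_poly (lam E)) 0 = 1" for E
    unfolding poly_lam by simp
  then show ?thesis
    unfolding poly_balance class_of_def
    by (intro arg_cong[of _ _ sum_mset] image_mset_cong)
      (simp add: balanced_factor_eq to_fract_prod prod_dividef)
qed


section \<open>The balanced I-function\<close>

lemma lookup_qw: "Poly_Mapping.lookup (qw m) 0 = m"
  by (simp only: qw_def lookup_single_eq)

lemma mem_sum_mset: "\<mu> \<in># (\<Sum>i\<in>A. E i) \<Longrightarrow> \<exists>i\<in>A. \<mu> \<in># E i"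
  by (induction A rule: infinite_finite_induct) auto

lemma lookup_root:
  "Poly_Mapping.lookup (tw i - tw j + qw m) 0 = m"
  "i \<noteq> j \<Longrightarrow> tw i - tw j + qw m \<noteq> 0"
proof -
  show "Poly_Mapping.lookup (tw i - tw j + qw m) 0 = m"
    by (simp add: tw_def qw_def lookup_add lookup_minus lookup_single)
  show "i \<noteq> j \<Longrightarrow> tw i - tw j + qw m \<noteq> 0"
  proof
    assume "i \<noteq> j" and 0: "tw i - tw j + qw m = 0"
    from 0 have "Poly_Mapping.lookup (tw i - tw j + qw m) (Suc i) = 0" by simp
    then show False using \<open>i \<noteq> j\<close>
      by (simp add: tw_def qw_def lookup_add lookup_minus lookup_single)
  qed
qed

lemma module_collection_Quot: "module_collection (Quot_indices S) (Quot_module n S)"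
proof -
  have "tw i - tw j + qw (- m) \<noteq> 0"
    if "m \<in> {- int (\<delta> i)..- int (\<delta> i) + int (\<delta> j) - 1}" for i j m and \<delta> :: "nat \<Rightarrow> nat"
  proof (cases "i = j")
    case True
    \<comment> \<open>On the diagonal the range of \<open>m\<close> is \<open>-\<delta>\<^sub>i..-1\<close>, so the power of \<open>q\<close> is never trivial.\<close>
    then have "m \<noteq> 0" using that by auto
    then show ?thesis using lookup_root(1)[of i j "- m"] by (metis lookup_zero neg_equal_0_iff_equal)
  qed (rule lookup_root)
  then have "0 \<notin># Quot_cot S \<delta>" for \<delta>
    by (force simp: Quot_cot_def dest!: mem_sum_mset)
  moreover have "tw i - tw j + qw (int m) \<noteq> 0" if "m \<in> {1..d}" for i j m d
    using lookup_root(1)[of i j "int m"] that by auto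
  then have "0 \<notin># Quot_cot_normal n S \<delta>" for \<delta>
    by (force simp: Quot_cot_normal_def dest!: mem_sum_mset)
  ultimately show ?thesis
    by (auto simp: module_collection_def Quot_indices_def intro!: lam_m1_nonzero)
qed

lemma I_formal_in_formal_sums: "I_formal S d \<in> formal_sums (Quot_indices S)"
proof -
  have "\<delta> \<in> S \<rightarrow>\<^sub>E UNIV" if "\<delta> \<in># mset_set (degree_splittings S d)" for \<delta>
    using that by (cases "finite (degree_splittings S d)") (auto simp: degree_splittings_def)
  then show ?thesis
    by (auto simp: I_formal_def formal_sums_def Quot_indices_def)
qed

lemma balanced_Quot_cot:
  assumes "finite S"
  shows "balanced_factor y (Quot_cot S \<delta>) = bal_B y S \<delta> * bal_C y S \<delta>"
proof -
  define g where "g i j m = (1 + y * (tF i / tF j) * qF powi (- m)) / (1 - tF i / tF j * qF powi (- m))"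
    for i j m
  define I where "I i j = {- int (\<delta> i)..- int (\<delta> i) + int (\<delta> j) - 1}" for i j
  have diag: "(\<Prod>m\<in>I i i. g i i m) = (\<Prod>m=1..\<delta> i. (1 + y * qF ^ m) / (1 - qF ^ m))" for i
    by (rule prod.reindex_bij_witness[of _ "\<lambda>m. - int m" "\<lambda>m. nat (- m)"])
      (auto simp: I_def g_def power_int_def)
  have "balanced_factor y (Quot_cot S \<delta>) = (\<Prod>i\<in>S. \<Prod>j\<in>S. \<Prod>m\<in>I i j. g i j m)"
    by (simp only: Quot_cot_def balanced_factor_sum balanced_factor_single character_root g_def I_def
        mult.assoc)
  also have "\<dots> = (\<Prod>i\<in>S. (\<Prod>m\<in>I i i. g i i m) * (\<Prod>j\<in>S - {i}. \<Prod>m\<in>I i j. g i j m))"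
    using assms by (intro prod.cong refl prod.remove)
  also have "\<dots> = (\<Prod>i\<in>S. \<Prod>m\<in>I i i. g i i m) * bal_C y S \<delta>"
    by (simp add: prod.distrib bal_C_def g_def I_def)
  finally show ?thesis by (simp add: bal_B_def diag)
qed

lemma balanced_Quot_cot_normal: "balanced_factor y (Quot_cot_normal n S \<delta>) = bal_A y n S \<delta>"
  by (simp only: Quot_cot_normal_def balanced_factor_sum balanced_factor_single character_root
      bal_A_def mult.assoc power_int_of_nat)

lemma poly_I_balanced_coeff:
  assumes "finite S"
  shows "poly (I_balanced_coeff n S d) y =
    (\<Sum>\<delta>\<in>degree_splittings S d. bal_A y n S \<delta> * bal_B y S \<delta> * bal_C y S \<delta>)"
  using assms
  by (simp add: I_balanced_coeff_def poly_balance I_formal_def image_mset.compositionality comp_def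
      sum_unfold_sum_mset balanced_Quot_cot balanced_Quot_cot_normal mult_ac)

lemma class_of_I_formal:
  assumes "finite S"
  shows "class_of (Quot_module n S) (I_formal S d) = I_coeff n S d"
proof -
  have "class_of (Quot_module n S) (I_formal S d) = poly (I_balanced_coeff n S d) 0"
    by (simp add: class_of_eq_poly_balance I_balanced_coeff_def)
  then show ?thesis
    using assms
    by (simp add: poly_I_balanced_coeff I_coeff_def bal_A_def bal_B_def bal_C_def I_A_def I_B_def I_C_def)
qed


section \<open>The vertex bracket as a balanced product\<close>

text \<open>The balanced factor of the weight \<open>w q\<^sup>m\<close> at \<open>y = -\<hbar>/q\<close>.\<close>

definition vertex_factor :: "Kloc \<Rightarrow> int \<Rightarrow> Kloc" where
  "vertex_factor w m = (1 + - (inverse qF * hF) * w * qF powi m) / (1 - w * qF powi m)"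

lemma prod_shift_int: "(\<Prod>k<n. F (c + int k)) = (\<Prod>m=c..c + int n - 1. F m)"
  by (rule prod.reindex_bij_witness[of _ "\<lambda>m. nat (m - c)" "\<lambda>k. c + int k"]) auto

text \<open>
  Since \<open>\<hbar> w q\<^sup>m\<^sup>-\<^sup>1 = -y w q\<^sup>m\<close> for \<open>y = -\<hbar>/q\<close>, the substitution makes the two Pochhammer symbols line
  up factor by factor. The free exponent \<open>c\<close> covers both signs of the index of a bracket: \<open>c = 0\<close> for
  \<open>d \<ge> 0\<close>, and \<open>c = d\<close> for \<open>d < 0\<close>.
\<close>

lemma qpoch_nat_quotient:
  "qpoch_nat qF (qF powi c * (hF * w)) n / qpoch_nat qF (qF powi c * (qF * w)) n
     = (\<Prod>m=c + 1..c + int n. vertex_factor w m)"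
proof -
  have "(1 - qF powi c * (hF * w) * qF ^ k) / (1 - qF powi c * (qF * w) * qF ^ k)
      = vertex_factor w (c + 1 + int k)" for k
    by (simp add: vertex_factor_def power_int_add field_simps)
  then have "qpoch_nat qF (qF powi c * (hF * w)) n / qpoch_nat qF (qF powi c * (qF * w)) n
      = (\<Prod>k<n. vertex_factor w (c + 1 + int k))"
    by (simp add: qpoch_nat_def prod_dividef[symmetric])
  then show ?thesis by (simp add: prod_shift_int)
qed

lemma vertex_bracket_nonneg:
  assumes "d \<ge> 0"
  shows "vertex_bracket u d = (\<Prod>m=1..d. vertex_factor (1 / u) m)"
  using qpoch_nat_quotient[of 0 "1 / u" "nat d"] assms
  by (simp add: vertex_bracket_def qpoch_def)

lemma vertex_bracket_nonpos:
  assumes "d \<le> 0"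
  shows "vertex_bracket u d = inverse (\<Prod>m=d + 1..0. vertex_factor (1 / u) m)"
proof (cases "d = 0")
  case False
  then show ?thesis
  using qpoch_nat_quotient[of d "1 / u" "nat (- d)", symmetric] assms
  by (simp add: vertex_bracket_def qpoch_def)
qed (simp add: vertex_bracket_def qpoch_def qpoch_nat_def)

text \<open>
  Telescoping. For \<open>a \<ge> b\<close> the shorter product cancels from the longer one, which needs nonzero
  factors; for \<open>a < b\<close> the inverted bracket of negative index extends the product below \<open>1\<close>. The
  change of sign of \<open>m\<close> produces the range of weights of the Quot scheme.
\<close>

lemma vertex_bracket_quotient:
  assumes nz: "\<And>m. vertex_factor (1 / u) m \<noteq> 0"
  shows "inverse (vertex_bracket u (int a - int b)) * vertex_bracket u (int a)
    = (\<Prod>m=- int a..- int a + int b - 1. vertex_factor (1 / u) (- m))"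
proof -
  define F where "F = vertex_factor (1 / u)"
  have split: "(\<Prod>m=l..k. F m) * (\<Prod>m=k + 1..h. F m) = (\<Prod>m=l..h. F m)"
    if "l \<le> k + 1" "k \<le> h" for l k h
  proof -
    have "{l..h} = {l..k} \<union> {k + 1..h}" "{l..k} \<inter> {k + 1..h} = {}" using that by auto
    then show ?thesis by (simp add: prod.union_disjoint)
  qed
  have "inverse (vertex_bracket u (int a - int b)) * vertex_bracket u (int a)
      = (\<Prod>m=int a - int b + 1..int a. F m)"
  proof (cases "a \<ge> b")
    case True
    have "(\<Prod>m=1..int a - int b. F m) \<noteq> 0"
      using nz by (simp add: F_def)
    then show ?thesis
      using True split[of 1 "int a - int b" "int a"]
      by (simp add: vertex_bracket_nonneg F_def field_simps)
  next
    case False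
    then show ?thesis
      using split[of "int a - int b + 1" 0 "int a"]
      by (simp add: vertex_bracket_nonneg vertex_bracket_nonpos F_def)
  qed
  also have "\<dots> = (\<Prod>m=- int a..- int a + int b - 1. F (- m))"
    by (rule prod.reindex_bij_witness[of _ uminus uminus]) auto
  finally show ?thesis by (simp add: F_def)
qed

text \<open>
  The numerator is \<open>1\<close> minus a character involving \<open>\<hbar>\<close>, the denominator \<open>1\<close> minus one involving
  \<open>t\<^sub>i/t\<^sub>j\<close>. Indices start at \<open>1\<close> because the exponent of \<open>t\<^sub>0\<close> would share its coordinate with that
  of \<open>\<hbar>\<close>.
\<close>

lemma vertex_factor_nonzero:
  assumes ij: "i \<noteq> j" and pos: "i \<ge> 1" "j \<ge> 1"
  shows "vertex_factor (tF i / tF j) m \<noteq> 0"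
proof -
  \<comment> \<open>The exponent \<open>m - 1\<close> appears because \<open>-y = \<hbar>/q\<close>.\<close>
  have "Poly_Mapping.lookup (hw + (tw i - tw j + qw (m - 1))) 1 = 1"
    using pos by (simp add: hw_def tw_def qw_def lookup_add lookup_minus lookup_single)
  then have "character (hw + (tw i - tw j + qw (m - 1))) \<noteq> 1"
    unfolding character_eq_1_iff by (metis lookup_zero zero_neq_one)
  then have "1 - hF * (tF i / tF j * qF powi (m - 1)) \<noteq> 0"
    by (simp add: character_add[of hw] character_root character_hw)
  moreover have "1 - tF i / tF j * qF powi m \<noteq> 0"
    using lookup_root(2)[OF ij, of m] character_eq_1_iff[of "tw i - tw j + qw m"]
    by (simp add: character_root)
  ultimately show ?thesis
    by (simp add: vertex_factor_def power_int_diff field_simps)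
qed

text \<open>
  The double product over \<open>S \<times> {1..n}\<close> is split into pairs with \<open>j\<close> outside \<open>S\<close>, diagonal pairs, and
  the remaining pairs in \<open>S\<close>; only the last kind meets the inverted brackets nontrivially.
\<close>

lemma vertex_term_eq_balanced_term:
  assumes S: "S \<subseteq> {1..n}"
  defines "y \<equiv> - (inverse qF * hF)"
  shows "(\<Prod>i\<in>S. \<Prod>j\<in>S. inverse (vertex_bracket (tF j / tF i) (int (\<delta> i) - int (\<delta> j)))) *
      (\<Prod>i\<in>S. \<Prod>j=1..n. vertex_bracket (tF j / tF i) (int (\<delta> i)))
    = bal_A y n S \<delta> * bal_B y S \<delta> * bal_C y S \<delta>"
proof -
  have fin: "finite S" using S finite_subset by blast
  define b where "b i j d = vertex_bracket (tF j / tF i) d" for i j d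
  have b_nat: "b i j (int d) = (\<Prod>m=1..d. vertex_factor (tF i / tF j) (int m))" for i j d
  proof -
    have "b i j (int d) = (\<Prod>m=1..int d. vertex_factor (tF i / tF j) m)"
      by (simp add: b_def vertex_bracket_nonneg)
    also have "\<dots> = (\<Prod>m=1..d. vertex_factor (tF i / tF j) (int m))"
      by (rule prod.reindex_bij_witness[of _ int nat]) auto
    finally show ?thesis .
  qed
  have A: "(\<Prod>i\<in>S. \<Prod>j\<in>{1..n} - S. b i j (int (\<delta> i))) = bal_A y n S \<delta>"
    by (simp only: b_nat bal_A_def vertex_factor_def y_def power_int_of_nat)
  have B: "(\<Prod>i\<in>S. b i i (int (\<delta> i))) = bal_B y S \<delta>"
    by (simp add: b_nat bal_B_def vertex_factor_def y_def)
  have "inverse (b i j (int (\<delta> i) - int (\<delta> j))) * b i j (int (\<delta> i)) =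
      (\<Prod>m=- int (\<delta> i)..- int (\<delta> i) + int (\<delta> j) - 1. vertex_factor (tF i / tF j) (- m))"
    if "i \<in> S" "j \<in> S - {i}" for i j
  proof -
    have "vertex_factor (1 / (tF j / tF i)) m \<noteq> 0" for m
    proof -
      have "i \<in> {1..n}" "j \<in> {1..n}" "i \<noteq> j" using S that by auto
      then show ?thesis using vertex_factor_nonzero[of i j m] by simp
    qed
    from vertex_bracket_quotient[OF this] show ?thesis by (simp add: b_def)
  qed
  then have C: "(\<Prod>i\<in>S. \<Prod>j\<in>S - {i}. inverse (b i j (int (\<delta> i) - int (\<delta> j))) * b i j (int (\<delta> i)))
      = bal_C y S \<delta>"
    unfolding bal_C_def by (simp add: vertex_factor_def y_def)
  have "(\<Prod>j\<in>S. inverse (b i j (int (\<delta> i) - int (\<delta> j)))) * (\<Prod>j=1..n. b i j (int (\<delta> i)))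
      = (\<Prod>j\<in>{1..n} - S. b i j (int (\<delta> i))) * b i i (int (\<delta> i)) *
        (\<Prod>j\<in>S - {i}. inverse (b i j (int (\<delta> i) - int (\<delta> j))) * b i j (int (\<delta> i)))"
    if i: "i \<in> S" for i
  proof -
    have "b i i 0 = 1" by (simp add: b_def vertex_bracket_nonneg)
    then have "(\<Prod>j\<in>S. inverse (b i j (int (\<delta> i) - int (\<delta> j))))
        = (\<Prod>j\<in>S - {i}. inverse (b i j (int (\<delta> i) - int (\<delta> j))))"
      using prod.remove[OF fin i, of "\<lambda>j. inverse (b i j (int (\<delta> i) - int (\<delta> j)))"] by simp
    moreover have "(\<Prod>j=1..n. b i j (int (\<delta> i)))
        = (\<Prod>j\<in>{1..n} - S. b i j (int (\<delta> i))) * (b i i (int (\<delta> i)) * (\<Prod>j\<in>S - {i}. b i j (int (\<delta> i))))"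
      by (simp only: prod.subset_diff[OF S finite_atLeastAtMost]
          prod.remove[OF fin i, of "\<lambda>j. b i j (int (\<delta> i))"])
    ultimately show ?thesis by (simp add: prod.distrib mult_ac)
  qed
  then show ?thesis
    unfolding A[symmetric] B[symmetric] C[symmetric] b_def prod.distrib[symmetric]
    by (rule prod.cong[OF refl])
qed

lemma vertex_coeff_eq_balanced:
  assumes "S \<subseteq> {1..n}"
  shows "vertex_coeff n S d = poly (I_balanced_coeff n S d) (- (inverse qF * hF))"
  using finite_subset[OF assms]
  by (simp only: vertex_coeff_def poly_I_balanced_coeff vertex_term_eq_balanced_term[OF assms]
      finite_atLeastAtMost)

section \<open>Units in a ring determined by fixed points\<close>

lemma ring_hom_map_simps:
  assumes "ring_hom_map f"
  shows "f 0 = 0" "f 1 = 1" "f (u + v) = f u + f v" "f (u * v) = f u * f v" "f (u - v) = f u - f v"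
    "f (u ^ k) = f u ^ k" "f (prod g A) = (\<Prod>i\<in>A. f (g i))" "f (sum g A) = (\<Sum>i\<in>A. f (g i))"
proof -
  have one: "f 1 = 1" and add: "f (u + v) = f u + f v" and mult: "f (u * v) = f u * f v" for u v
    using assms by (auto simp: ring_hom_map_def)
  show zero: "f 0 = 0" using add[of 0 0] by simp
  show "f 1 = 1" "f (u + v) = f u + f v" "f (u * v) = f u * f v" by (fact one add mult)+
  show "f (u - v) = f u - f v" using add[of "u - v" v] by simp
  show "f (u ^ k) = f u ^ k" by (induction k) (simp_all add: one mult)
  show "f (prod g A) = (\<Prod>i\<in>A. f (g i))"
    by (induction A rule: infinite_finite_induct) (simp_all add: one mult)
  show "f (sum g A) = (\<Sum>i\<in>A. f (g i))"
    by (induction A rule: infinite_finite_induct) (simp_all add: zero add)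
qed

lemma map_poly_hom_mult:
  assumes "ring_hom_map f"
  shows "map_poly f (p * r) = map_poly f p * map_poly f r"
  by (rule poly_eqI) (simp add: coeff_map_poly coeff_mult ring_hom_map_simps[OF assms])

lemma map_poly_hom_prod:
  assumes "ring_hom_map f"
  shows "map_poly f (\<Prod>i\<in>A. p i) = (\<Prod>i\<in>A. map_poly f (p i))"
  by (induction A rule: infinite_finite_induct)
    (simp_all add: map_poly_hom_mult[OF assms] ring_hom_map_simps[OF assms])

lemma ring_inverse_right:
  assumes "u dvd (1 :: 'k::comm_ring_1)"
  shows "u * ring_inverse u = 1"
proof -
  obtain v where v: "u * v = 1" using assms by (metis dvdE)
  have "\<exists>!v. u * v = 1"
  proof (rule ex1I[of _ v])
    show "u * v = 1" by (fact v)
  next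
    fix w assume w: "u * w = 1"
    have "w = (u * v) * w" by (simp add: v)
    also have "\<dots> = v * (u * w)" by (simp add: mult_ac)
    finally show "w = v" by (simp add: w)
  qed
  then show ?thesis unfolding ring_inverse_def by (rule theI')
qed

lemma dvd_prod_diff_prod:
  fixes u v :: "'b \<Rightarrow> 'k::comm_ring_1"
  assumes "\<And>x. x \<in> A \<Longrightarrow> e dvd u x - v x"
  shows "e dvd prod u A - prod v A"
  using assms
proof (induction A rule: infinite_finite_induct)
  case (insert x A)
  have "prod u (insert x A) - prod v (insert x A)
      = (u x - v x) * prod u A + v x * (prod u A - prod v A)"
    using insert.hyps by (simp add: algebra_simps)
  then show ?case using insert by (simp add: dvd_add)
qed simp_all

text \<open>
  Modulo \<open>1 - s a\<close> one may replace \<open>1\<close> by \<open>s a\<close>, which turns the product into a multiple of the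
  vanishing product \<open>\<Prod>\<^sub>x (a - c\<^sub>x)\<close>.
\<close>

lemma one_minus_dvd_prod_one_minus_roots:
  fixes a :: "'k::comm_ring_1"
  assumes "finite P" and root: "(\<Prod>x\<in>P. a - c x) = 0"
  shows "1 - s * a dvd (\<Prod>x\<in>P. 1 - s * c x)"
proof -
  have "1 - s * a dvd (\<Prod>x\<in>P. 1 - s * c x) - (\<Prod>x\<in>P. s * (a - c x))"
    by (rule dvd_prod_diff_prod) (simp add: algebra_simps)
  then show ?thesis by (simp add: prod.distrib root)
qed

text \<open>At each fixed point one of the factors restricts to \<open>0\<close>, and restriction is jointly injective.\<close>

lemma prod_restriction_differences_eq_0:
  assumes K: "fixed_point_K_ring P \<iota> res"
    and a: "\<And>x. x \<in> P \<Longrightarrow> res x a = to_fract (c x)"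
  shows "(\<Prod>x\<in>P. a - \<iota> (c x)) = 0"
proof -
  have "res z (\<Prod>x\<in>P. a - \<iota> (c x)) = res z 0" if z: "z \<in> P" for z
  proof -
    have hom: "ring_hom_map (res z)" and \<iota>: "\<And>c. res z (\<iota> c) = to_fract c" and fin: "finite P"
      using K z by (auto simp: fixed_point_K_ring_def)
    have "res z (\<Prod>x\<in>P. a - \<iota> (c x)) = (\<Prod>x\<in>P. res z a - to_fract (c x))"
      by (simp add: ring_hom_map_simps[OF hom] \<iota>)
    also have "\<dots> = 0" using fin z a[OF z] by (auto simp: prod_zero_iff)
    finally show ?thesis by (simp add: ring_hom_map_simps[OF hom])
  qed
  then show ?thesis using K unfolding fixed_point_K_ring_def by blast
qed

lemma prod_dvd_one: "(\<And>i. i \<in> A \<Longrightarrow> f i dvd 1) \<Longrightarrow> (\<Prod>i\<in>A. f i) dvd (1 :: 'k::comm_ring_1)"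
  using prod_dvd_prod[of A f "\<lambda>_. 1"] by simp

lemma lam_weight_module: "lam (weight_module \<xi> (x, i, l)) = [:1, emon (\<xi> x i + qw (int l)):]"
  and lam_m1_weight_module: "lam_m1 (weight_module \<xi> (x, i, l)) = 1 - emon (\<xi> x i + qw (int l))"
  by (simp_all add: weight_module_def lam_def lam_m1_def)

text \<open>
  Invertibility is assumed only for the images of the elements \<open>1 - q\<^sup>l \<chi>\<close> of the base ring,
  \<open>\<chi>\<close> running over the restrictions of \<open>a\<^sub>i\<close>. It passes to \<open>1 - q\<^sup>l a\<^sub>i\<close> because a divisor of a unit is a unit.
\<close>

lemma one_minus_power_unit:
  assumes K: "fixed_point_K_ring P \<iota> res"
    and res_a: "\<And>x. x \<in> P \<Longrightarrow> res x (a i) = to_fract (emon (\<xi> x i))"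
    and inv: "\<And>x. x \<in> P \<Longrightarrow> \<iota> (lam_m1 (weight_module \<xi> (x, i, l))) dvd 1"
  shows "1 - \<iota> (emon (qw 1)) ^ l * a i dvd 1"
proof -
  have hom: "ring_hom_map \<iota>" and fin: "finite P" using K by (auto simp: fixed_point_K_ring_def)
  have "1 - \<iota> (emon (qw 1)) ^ l * a i dvd (\<Prod>x\<in>P. 1 - \<iota> (emon (qw 1)) ^ l * \<iota> (emon (\<xi> x i)))"
    by (intro one_minus_dvd_prod_one_minus_roots fin prod_restriction_differences_eq_0[OF K] res_a)
  also have "\<dots> = (\<Prod>x\<in>P. \<iota> (lam_m1 (weight_module \<xi> (x, i, l))))"
    by (simp add: lam_m1_weight_module emon_add emon_qw_power ring_hom_map_simps[OF hom] mult_ac)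
  also have "\<dots> dvd 1" by (rule prod_dvd_one) (rule inv)
  finally show ?thesis .
qed


section \<open>Difference operators with constant coefficients\<close>

lemma nth_apply_factors:
  fixes c :: "nat \<Rightarrow> 'b::comm_ring_1"
  shows "fps_nth (apply_factors (map (\<lambda>i f. fps_const (c i) * q_shift q f) is) f) d
    = (\<Prod>i\<leftarrow>is. 1 - c i * q ^ d) * fps_nth f d"
  by (induction "is") (simp_all add: apply_factors_def q_shift_def algebra_simps)

text \<open>
  On the coefficient of \<open>Q\<^sup>d\<close> the operator \<open>M\<close> is multiplication by \<open>X = c q\<^sup>d\<close>, so the geometric
  series inverts multiplication by \<open>1 - h X\<close>. Truncating it at \<open>k \<le> m\<close> leaves the error term
  \<open>(h X)\<^sup>m\<^sup>+\<^sup>1\<close>, which does not reach \<open>y\<^sup>m\<close> because \<open>h\<close> has no constant term.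
\<close>

lemma geometric_op_cancel:
  fixes h :: "'k::comm_ring_1 fps" and g :: "'k fps fps"
  assumes h: "fps_nth h 0 = 0"
  shows "geometric_op h (\<lambda>f. fps_const c * q_shift q f)
      (Abs_fps (\<lambda>d. (1 - h * (c * q ^ d)) * fps_nth g d)) = g"
proof -
  define M where "M = (\<lambda>f :: 'k fps fps. fps_const c * q_shift q f)"
  have iter: "fps_nth ((M ^^ k) f) d = (c * q ^ d) ^ k * fps_nth f d" for k f d
    by (induction k) (simp_all add: M_def q_shift_def mult_ac)
  have "(\<Sum>k\<le>m. fps_nth (h ^ k * (X ^ k * ((1 - h * X) * u))) m) = fps_nth u m" for X u m
  proof -
    have "(\<Sum>k\<le>m. h ^ k * (X ^ k * ((1 - h * X) * u))) = ((1 - h * X) * (\<Sum>k<Suc m. (h * X) ^ k)) * u"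
      by (simp add: sum_distrib_left sum_distrib_right power_mult_distrib mult_ac lessThan_Suc_atMost)
    also have "\<dots> = (1 - (h * X) ^ Suc m) * u"
      by (simp only: one_diff_power_eq)
    finally have eq: "(\<Sum>k\<le>m. h ^ k * (X ^ k * ((1 - h * X) * u))) = u - (h * X) ^ Suc m * u"
      by (simp add: algebra_simps)
    have "fps_nth ((h * X) ^ Suc m) k = 0" if "k \<le> m" for k
      using startsby_zero_power_prefix[of "h * X" "Suc m"] h that by (auto simp del: power_Suc)
    then have "fps_nth ((h * X) ^ Suc m * u) m = 0"
      by (simp add: fps_mult_nth del: power_Suc)
    then show ?thesis
      by (simp only: fps_sum_nth[symmetric] eq fps_sub_nth diff_zero)
  qed
  then show ?thesis
    unfolding M_def[symmetric] geometric_op_def iter by (simp add: fps_eq_iff)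
qed

lemma foldr_geometric_op_cancel:
  fixes h :: "'k::comm_ring_1 fps" and f g :: "'k fps fps"
  assumes h: "fps_nth h 0 = 0"
    and f: "\<And>d. fps_nth f d = (\<Prod>i\<leftarrow>is. 1 - h * (c i * q ^ d)) * fps_nth g d"
  shows "foldr (\<lambda>M g. geometric_op h M \<circ> g) (map (\<lambda>i f. fps_const (c i) * q_shift q f) is) id f = g"
proof -
  \<comment> \<open>Naming the folded function keeps rewriting from unfolding the composition under the fold.\<close>
  define F where "F = (\<lambda>M (g :: 'k fps operator). geometric_op h M \<circ> g)"
  have F: "F M g f = geometric_op h M (g f)" for M g f by (simp add: F_def)
  have "foldr F (map (\<lambda>i f. fps_const (c i) * q_shift q f) is) id f = g"
    using f
  proof (induction "is" arbitrary: g)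
    case Nil
    then show ?case by (simp add: fps_eq_iff)
  next
    case (Cons i "is")
    let ?M = "\<lambda>i f. fps_const (c i) * q_shift q f"
    have "foldr F (map ?M is) id f
        = Abs_fps (\<lambda>d. (1 - h * (c i * q ^ d)) * fps_nth g d)"
      by (rule Cons.IH) (simp add: Cons.prems mult_ac)
    moreover have "foldr F (map ?M (i # is)) id f = F (?M i) (foldr F (map ?M is) id) f"
      by (simp only: list.map foldr.simps comp_apply)
    ultimately show ?case by (simp only: F[of "?M i"] geometric_op_cancel[OF h])
  qed
  then show ?thesis by (simp only: F_def)
qed


section \<open>The series and its balancing\<close>

lemma prod_list_interval: "(\<Prod>i\<leftarrow>[1..<Suc n]. f i) = (\<Prod>i=1..n. f i)"
  by (subst prod.distinct_set_conv_list[symmetric]) (simp_all add: atLeastLessThanSuc_atLeastAtMost del: upt_Suc)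

lemma I_denominator_Suc:
  "I_denominator \<iota> n a (Suc d) = I_denominator \<iota> n a d * (\<Prod>i=1..n. 1 - a i * \<iota> (emon (qw 1)) ^ Suc d)"
  by (simp add: I_denominator_def qpoch_nat_def prod.distrib mult_ac)

lemma I_denominator_unit:
  assumes "\<And>i l. i \<in> {1..n} \<Longrightarrow> l \<ge> 1 \<Longrightarrow> 1 - \<iota> (emon (qw 1)) ^ l * a i dvd 1"
  shows "I_denominator \<iota> n a d dvd 1"
  unfolding I_denominator_def qpoch_nat_def
  by (intro prod_dvd_one) (use assms[of _ "Suc _"] in \<open>simp add: mult_ac\<close>)

lemma I_series_recurrence:
  assumes unit: "\<And>d. I_denominator \<iota> n a d dvd 1"
  shows "(\<Prod>i=1..n. 1 - a i * \<iota> (emon (qw 1)) ^ Suc d) * fps_nth (I_series \<iota> n a) (Suc d)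
    = fps_nth (I_series \<iota> n a) d"
proof -
  define u v where "u = I_denominator \<iota> n a d" and "v = I_denominator \<iota> n a (Suc d)"
  define p where "p = (\<Prod>i=1..n. 1 - a i * \<iota> (emon (qw 1)) ^ Suc d)"
  have v: "v = u * p" by (simp add: u_def v_def p_def I_denominator_Suc)
  have "p * ring_inverse v = ring_inverse u * (u * p) * ring_inverse v"
    using ring_inverse_right[OF unit[of d]] by (simp add: u_def mult_ac)
  also have "\<dots> = ring_inverse u"
    using ring_inverse_right[OF unit[of "Suc d"]] unfolding v[symmetric]
    by (simp add: v_def mult.assoc)
  finally show ?thesis by (simp add: I_series_def u_def v_def p_def)
qed

lemma D_annihilates_I_series:
  assumes unit: "\<And>d. I_denominator \<iota> n a d dvd 1"
    and rel: "(\<Prod>i=1..n. 1 - a i) = 0"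
  shows "apply_expr (D_expr (\<iota> (emon (qw 1))) n a) (I_series \<iota> n a) = 0"
proof (rule fps_ext)
  fix d
  show "fps_nth (apply_expr (D_expr (\<iota> (emon (qw 1))) n a) (I_series \<iota> n a)) d = fps_nth 0 d"
    using rel I_series_recurrence[OF unit]
    by (cases d)
      (simp_all add: apply_expr_def D_expr_def nth_apply_factors prod_list_interval del: One_nat_def upt_Suc power_Suc)
qed

text \<open>
  The explicit lift to the K-ring of the fixed-point data of \<open>\<B>\<^sub>y(\<I>)\<close>. Joint injectivity of the
  restrictions makes it the only one.
\<close>

definition I_series_balanced :: "(Kpt \<Rightarrow> 'k::comm_ring_1) \<Rightarrow> nat \<Rightarrow> (nat \<Rightarrow> 'k) \<Rightarrow> 'k poly fps" where
  "I_series_balanced \<iota> n a = Abs_fps (\<lambda>d.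
     smult (fps_nth (I_series \<iota> n a) d) (\<Prod>i=1..n. \<Prod>l=1..d. [:1, \<iota> (emon (qw 1)) ^ l * a i:]))"

lemma is_balanced_class_I_series:
  assumes K: "fixed_point_K_ring P \<iota> res"
    and res_a: "\<And>x i. x \<in> P \<Longrightarrow> i \<in> {1..n} \<Longrightarrow> res x (a i) = to_fract (emon (\<xi> x i))"
    and unit: "\<And>d. I_denominator \<iota> n a d dvd 1"
  shows "is_balanced_class P res (weight_indices P n) (weight_module \<xi>) (I_series_formal n)
    (I_series \<iota> n a) (I_series_balanced \<iota> n a)"
  unfolding is_balanced_class_def
proof (intro ballI allI conjI)
  fix x and d :: nat assume x: "x \<in> P"
  let ?V = "weight_module \<xi>"
  let ?J = "{x} \<times> {1..n} \<times> {1..d}"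
  have hom: "ring_hom_map (res x)" and \<iota>: "\<And>c. res x (\<iota> c) = to_fract c"
    using K x by (auto simp: fixed_point_K_ring_def)
  have prod_J: "(\<Prod>j\<in>?J. F j) = (\<Prod>i=1..n. \<Prod>l=1..d. F (x, i, l))"
    for F :: "_ \<Rightarrow> 'c::comm_monoid_mult"
    by (simp add: prod.cartesian_product')
  show "I_series_formal n x d \<in> formal_sums (weight_indices P n)"
    using x by (auto simp: I_series_formal_def formal_sums_def weight_indices_def)
  have "res x (I_denominator \<iota> n a d) = (\<Prod>i=1..n. \<Prod>k<d. 1 - to_fract (emon (\<xi> x i + qw (int (Suc k)))))"
    unfolding I_denominator_def qpoch_nat_def ring_hom_map_simps[OF hom]
    by (intro prod.cong refl)
      (simp only: res_a[OF x] \<iota> emon_add emon_qw_power to_fract_mult to_fract_power, simp add: mult_ac)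
  also have "\<dots> = to_fract (\<Prod>j\<in>?J. lam_m1 (?V j))"
    unfolding to_fract_prod prod_J lam_m1_weight_module
    by (rule prod.cong[OF refl])
      (simp only: One_nat_def prod.atLeast1_atMost_eq to_fract_diff to_fract_1)
  finally have den: "res x (I_denominator \<iota> n a d) = to_fract (\<Prod>j\<in>?J. lam_m1 (?V j))" .
  have "res x (I_denominator \<iota> n a d) * res x (fps_nth (I_series \<iota> n a) d) = 1"
    using ring_inverse_right[OF unit[of d]]
    by (simp add: I_series_def ring_hom_map_simps[OF hom, symmetric])
  then have coeff: "res x (fps_nth (I_series \<iota> n a) d) = 1 / to_fract (\<Prod>j\<in>?J. lam_m1 (?V j))"
    unfolding den by (metis mult_zero_left nonzero_mult_div_cancel_left zero_neq_one)
  then show "class_of ?V (I_series_formal n x d) = res x (fps_nth (I_series \<iota> n a) d)"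
    by (simp add: class_of_def I_series_formal_def)
  have "map_poly (res x) [:1, \<iota> (emon (qw 1)) ^ l * a i:] = fract_poly (lam (?V (x, i, l)))"
    if "i \<in> {1..n}" for i l
    using res_a[OF x that]
    by (simp add: map_poly_pCons ring_hom_map_simps[OF hom] \<iota> lam_weight_module emon_add emon_qw_power
        to_fract_power mult_ac)
  then have "(\<Prod>i=1..n. \<Prod>l=1..d. map_poly (res x) [:1, \<iota> (emon (qw 1)) ^ l * a i:])
      = fract_poly (\<Prod>j\<in>?J. lam (?V j))"
    unfolding prod_J fract_poly_prod by (intro prod.cong refl) blast
  then show "balance ?V (I_series_formal n x d) = map_poly (res x) (fps_nth (I_series_balanced \<iota> n a) d)"
    by (simp add: balance_def I_series_formal_def I_series_balanced_def map_poly_smult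
        map_poly_hom_prod[OF hom] coeff ring_hom_map_simps[OF hom])
qed

lemma is_balanced_class_unique:
  assumes K: "fixed_point_K_ring P \<iota> res"
    and "is_balanced_class P res \<Lambda> V pres \<gamma> B" "is_balanced_class P res \<Lambda> V pres \<gamma> B'"
  shows "B = B'"
proof (intro fps_ext poly_eqI)
  fix d m
  have "res x (coeff (fps_nth B d) m) = res x (coeff (fps_nth B' d) m)" if x: "x \<in> P" for x
  proof -
    have "ring_hom_map (res x)" using K x by (auto simp: fixed_point_K_ring_def)
    then have "res x 0 = 0" by (rule ring_hom_map_simps)
    moreover have "map_poly (res x) (fps_nth B d) = map_poly (res x) (fps_nth B' d)"
      using assms(2,3) x unfolding is_balanced_class_def by metis
    ultimately show ?thesis by (metis coeff_map_poly)
  qed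
  then show "coeff (fps_nth B d) m = coeff (fps_nth B' d) m"
    using K unfolding fixed_point_K_ring_def by blast
qed

text \<open>
  It suffices to find a series whose coefficients, multiplied by \<open>\<Prod>\<^sub>i (1 + y a\<^sub>i q\<^sup>d)\<close>, are those of
  the operator \<open>\<Prod>\<^sub>i (1 - a\<^sub>i q\<^sup>Q\<^sup>\<partial>)\<close> applied to \<open>\<B>\<^sub>y(\<I>)\<close>. This series is \<open>Q \<B>\<^sub>y(\<I>)\<close>, which
  the remaining summand \<open>-Q\<close> of the operator cancels.
\<close>

lemma balanced_D_annihilates_I_series_balanced:
  fixes a :: "nat \<Rightarrow> 'k::comm_ring_1"
  assumes unit: "\<And>d. I_denominator \<iota> n a d dvd 1"
    and rel: "(\<Prod>i=1..n. 1 - a i) = 0"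
  shows "balance_op (- fps_X) (D_expr (fps_const (\<iota> (emon (qw 1)))) n (\<lambda>i. fps_const (a i)))
    (in_series_y (I_series_balanced \<iota> n a)) = 0"
proof -
  let ?q = "\<iota> (emon (qw 1))"
  let ?Q = "fps_const ?q"
  let ?A = "\<lambda>i. fps_const (a i)"
  let ?f = "in_series_y (I_series_balanced \<iota> n a)"
  let ?Ms = "map (\<lambda>i f. fps_const (?A i) * q_shift ?Q f) [1..<Suc n]"
  have lin: "fps_of_poly [:1, c:] = 1 + fps_X * fps_const c" for c :: 'k
    by (simp add: fps_of_poly_pCons mult_ac)
  have f: "fps_nth ?f d = fps_const (fps_nth (I_series \<iota> n a) d) *
      (\<Prod>i=1..n. \<Prod>l=1..d. 1 + fps_X * (?A i * ?Q ^ l))" for d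
    by (simp add: in_series_y_def I_series_balanced_def fps_of_poly_smult fps_of_poly_prod lin
        fps_const_power mult_ac)
  have const: "(\<Prod>i=1..n. 1 - ?A i * ?Q ^ d) = fps_const (\<Prod>i=1..n. 1 - a i * ?q ^ d)" for d
  proof -
    have "(\<Prod>i\<in>I. 1 - ?A i * ?Q ^ d) = fps_const (\<Prod>i\<in>I. 1 - a i * ?q ^ d)" for I
      by (induction I rule: infinite_finite_induct)
        (simp_all add: fps_const_power flip: fps_const_1_eq_1 fps_const_mult fps_const_sub)
    then show ?thesis .
  qed
  have "fps_nth (apply_factors ?Ms ?f) d
      = (\<Prod>i\<leftarrow>[1..<Suc n]. 1 - (- fps_X) * (?A i * ?Q ^ d)) * fps_nth (fps_X * ?f) d" for d
  proof (cases d)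
    case 0
    then show ?thesis
      using const[of 0] rel by (simp add: nth_apply_factors prod_list_interval del: One_nat_def upt_Suc)
  next
    case (Suc e)
    let ?c = "\<lambda>d. fps_const (fps_nth (I_series \<iota> n a) d)"
    have "(\<Prod>i=1..n. 1 - ?A i * ?Q ^ d) * ?c d = ?c e"
      unfolding const Suc using I_series_recurrence[OF unit, of e] by (simp del: power_Suc)
    then have "((\<Prod>i=1..n. 1 - ?A i * ?Q ^ d) * ?c d) * R = ?c e * R" for R
      by simp
    then have "(\<Prod>i=1..n. 1 - ?A i * ?Q ^ d) * fps_nth ?f d
        = ?c e * (\<Prod>i=1..n. \<Prod>l=1..d. 1 + fps_X * (?A i * ?Q ^ l))"
      unfolding f mult.assoc[of _ "?c d"] by blast
    also have "\<dots> = (\<Prod>i=1..n. 1 + fps_X * (?A i * ?Q ^ d)) * fps_nth ?f e"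
      unfolding f Suc by (simp add: prod.distrib mult_ac del: power_Suc)
    finally show ?thesis
      by (simp add: Suc nth_apply_factors prod_list_interval del: One_nat_def upt_Suc power_Suc)
  qed
  then have "foldr (\<lambda>M g. geometric_op (- fps_X) M \<circ> g) ?Ms id (apply_factors ?Ms ?f) = fps_X * ?f"
    by (intro foldr_geometric_op_cancel) simp_all
  then show ?thesis by (simp add: balance_op_def D_expr_def del: upt_Suc)
qed

theorem theorem1p2:
  fixes n r :: nat and S :: "nat set"
    and N :: nat and P :: "'x set"
    and \<iota> :: "Kpt \<Rightarrow> 'k::comm_ring_1" and res :: "'x \<Rightarrow> 'k \<Rightarrow> Kloc"
    and a :: "nat \<Rightarrow> 'k" and \<xi> :: "'x \<Rightarrow> nat \<Rightarrow> weight"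
  shows
    "(S \<subseteq> {1..n} \<and> card S = r \<longrightarrow>
        module_collection (Quot_indices S) (Quot_module n S) \<and>
        (\<forall>d. I_formal S d \<in> formal_sums (Quot_indices S) \<and>
             class_of (Quot_module n S) (I_formal S d) = fps_nth (I_function n S) d \<and>
             (\<forall>y. poly (I_balanced_coeff n S d) y =
                    (\<Sum>\<delta>\<in>degree_splittings S d. bal_A y n S \<delta> * bal_B y S \<delta> * bal_C y S \<delta>))) \<and>
        vertex_function n S = I_balanced (- (inverse qF * hF)) n S \<and>
        (\<forall>d. vertex_coeff n S d = poly (I_balanced_coeff n S d) (- (inverse qF * hF))))
     \<and>
     (fixed_point_K_ring P \<iota> res \<and>
      (\<forall>x\<in>P. \<forall>i\<in>{1..N}.
         Poly_Mapping.lookup (\<xi> x i) 0 = 0 \<and> res x (a i) = to_fract (emon (\<xi> x i))) \<and>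
      (\<Prod>i=1..N. 1 - a i) = 0 \<and>
      (\<forall>j\<in>weight_indices P N. \<iota> (lam_m1 (weight_module \<xi> j)) dvd 1) \<longrightarrow>
        module_collection (weight_indices P N) (weight_module \<xi>) \<and>
        (\<forall>d. I_denominator \<iota> N a d dvd 1) \<and>
        apply_expr (D_expr (\<iota> (emon (qw 1))) N a) (I_series \<iota> N a) = 0 \<and>
        (\<exists>!B. is_balanced_class P res (weight_indices P N) (weight_module \<xi>)
                (I_series_formal N) (I_series \<iota> N a) B) \<and>
        (\<forall>B. is_balanced_class P res (weight_indices P N) (weight_module \<xi>)
               (I_series_formal N) (I_series \<iota> N a) B \<longrightarrow>
             balance_op (- fps_X) (D_expr (fps_const (\<iota> (emon (qw 1)))) N (\<lambda>i. fps_const (a i)))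
               (in_series_y B) = 0))"
proof (rule conjI; rule impI)
  assume "S \<subseteq> {1..n} \<and> card S = r"
  then have S: "S \<subseteq> {1..n}" and fin: "finite S" using finite_subset by auto
  have "vertex_function n S = I_balanced (- (inverse qF * hF)) n S"
    by (simp add: vertex_function_def I_balanced_def fps_eq_iff vertex_coeff_eq_balanced[OF S])
  then show "module_collection (Quot_indices S) (Quot_module n S) \<and>
        (\<forall>d. I_formal S d \<in> formal_sums (Quot_indices S) \<and>
             class_of (Quot_module n S) (I_formal S d) = fps_nth (I_function n S) d \<and>
             (\<forall>y. poly (I_balanced_coeff n S d) y =
                    (\<Sum>\<delta>\<in>degree_splittings S d. bal_A y n S \<delta> * bal_B y S \<delta> * bal_C y S \<delta>))) \<and>
        vertex_function n S = I_balanced (- (inverse qF * hF)) n S \<and>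
        (\<forall>d. vertex_coeff n S d = poly (I_balanced_coeff n S d) (- (inverse qF * hF)))"
    using module_collection_Quot I_formal_in_formal_sums class_of_I_formal[OF fin]
      poly_I_balanced_coeff[OF fin] vertex_coeff_eq_balanced[OF S]
    by (simp add: I_function_def)
next
  assume asm: "fixed_point_K_ring P \<iota> res \<and>
      (\<forall>x\<in>P. \<forall>i\<in>{1..N}.
         Poly_Mapping.lookup (\<xi> x i) 0 = 0 \<and> res x (a i) = to_fract (emon (\<xi> x i))) \<and>
      (\<Prod>i=1..N. 1 - a i) = 0 \<and>
      (\<forall>j\<in>weight_indices P N. \<iota> (lam_m1 (weight_module \<xi> j)) dvd 1)"
  then have K: "fixed_point_K_ring P \<iota> res" and rel: "(\<Prod>i=1..N. 1 - a i) = 0"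
    and res_a: "\<And>x i. x \<in> P \<Longrightarrow> i \<in> {1..N} \<Longrightarrow> res x (a i) = to_fract (emon (\<xi> x i))"
    by blast+
  have "\<xi> x i + qw (int l) \<noteq> 0" if "x \<in> P" "i \<in> {1..N}" "l \<ge> 1" for x i l
  proof
    assume "\<xi> x i + qw (int l) = 0"
    then have "Poly_Mapping.lookup (\<xi> x i + qw (int l)) 0 = 0" by simp
    then show False using asm that by (simp add: lookup_add lookup_qw)
  qed
  then have coll: "module_collection (weight_indices P N) (weight_module \<xi>)"
    by (auto simp: module_collection_def weight_indices_def weight_module_def intro!: lam_m1_nonzero)
  have unit: "I_denominator \<iota> N a d dvd 1" for d
  proof (intro I_denominator_unit one_minus_power_unit[OF K, of a _ \<xi>] res_a)
    fix i l x assume "i \<in> {1..N}" "(1::nat) \<le> l" "x \<in> P"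
    then show "\<iota> (lam_m1 (weight_module \<xi> (x, i, l))) dvd 1"
      using asm by (auto simp: weight_indices_def)
  qed
  note bal = is_balanced_class_I_series[OF K res_a unit]
  note uniq = is_balanced_class_unique[OF K _ bal]
  show "module_collection (weight_indices P N) (weight_module \<xi>) \<and>
        (\<forall>d. I_denominator \<iota> N a d dvd 1) \<and>
        apply_expr (D_expr (\<iota> (emon (qw 1))) N a) (I_series \<iota> N a) = 0 \<and>
        (\<exists>!B. is_balanced_class P res (weight_indices P N) (weight_module \<xi>)
                (I_series_formal N) (I_series \<iota> N a) B) \<and>
        (\<forall>B. is_balanced_class P res (weight_indices P N) (weight_module \<xi>)
               (I_series_formal N) (I_series \<iota> N a) B \<longrightarrow>
             balance_op (- fps_X) (D_expr (fps_const (\<iota> (emon (qw 1)))) N (\<lambda>i. fps_const (a i)))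
               (in_series_y B) = 0)"
    using coll unit D_annihilates_I_series[OF unit rel] bal uniq
      balanced_D_annihilates_I_series_balanced[OF unit rel]
    by blast
qed

end
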